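(* Let $G$ be a finite simple (unweighted) graph with adjacency matrix $A$, and suppose perfect state transfer occurs between two vertices of $G$. If $t$ is the minimum positive time at which this perfect state transfer occurs, then $t\le\pi/\sqrt{2}$.
   Context: Perfect state transfer between distinct vertices $i$ and $j$ at time $t>0$ means $\exp(\mathrm{i}tA)e_i=\gamma e_j$ for some $\gamma\in\mathbb{C}$ with $|\gamma|=1$, where $e_i,e_j$ are the standard basis vectors of the vertices. *)

theory Defs
  imports "HOL-Analysis.Analysis"
begin

definition simple_graph :: "('n::finite \<Rightarrow> 'n \<Rightarrow> bool) \<Rightarrow> bool" where
  "simple_graph E \<longleftrightarrow> (\<forall>u v. E u v \<longleftrightarrow> E v u) \<and> (\<forall>u. \<not> E u u)"

definition adj_matrix :: "('n::finite \<Rightarrow> 'n \<Rightarrow> bool) \<Rightarrow> complex^'n^'n" where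
  "adj_matrix E = (\<chi> i j. if E i j then 1 else 0)"

primrec mat_pow :: "complex^'n^'n \<Rightarrow> nat \<Rightarrow> complex^'n^'n" where
  "mat_pow M 0 = mat 1"
| "mat_pow M (Suc k) = M ** mat_pow M k"

definition mat_exp :: "complex^'n::finite^'n \<Rightarrow> complex^'n^'n" where
  "mat_exp M = (\<chi> i j. \<Sum>k. (mat_pow M k) $ i $ j / of_nat (fact k))"

definition basis_vec :: "'n::finite \<Rightarrow> complex^'n" where
  "basis_vec i = (\<chi> j. if j = i then 1 else 0)"

definition PST :: "('n::finite \<Rightarrow> 'n \<Rightarrow> bool) \<Rightarrow> 'n \<Rightarrow> 'n \<Rightarrow> real \<Rightarrow> bool" where
  "PST E u v t \<longleftrightarrow> u \<noteq> v \<and> t > 0 \<and>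
     (\<exists>\<gamma>::complex. norm \<gamma> = 1 \<and>
        mat_exp (\<chi> a b. (\<i> * complex_of_real t) * adj_matrix E $ a $ b) *v basis_vec u
        = \<gamma> *s basis_vec v)"

end

theory Submission
  imports Defs
begin

text \<open>
  Write \<open>e\<^sub>u = \<Sum> w\<^sub>\<theta>\<close> with nonzero eigenvectors \<open>w\<^sub>\<theta>\<close>, \<open>\<theta> \<in> T\<close>. State transfer at time
  \<open>t\<close> forces \<open>e\<^sub>v = \<Sum> c\<^sub>\<theta> w\<^sub>\<theta>\<close> with signs \<open>c\<^sub>\<theta>\<close>, and \<open>\<theta> - \<theta>' = s (m\<^sub>\<theta> - m\<^sub>\<theta>\<^sub>')\<close> with
  \<open>s = \<pi> / t\<close> and integers \<open>m\<^sub>\<theta>\<close> whose parity encodes the sign. If the gcd \<open>g\<close> of the \<open>m\<^sub>\<theta>\<close> (normalised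
  by \<open>m\<^sub>k = 0\<close> for one \<open>k \<in> T\<close>) exceeded 1, it would be odd and \<open>t / g\<close> would be an earlier
  time; so \<open>g = 1\<close>.

  The polynomial \<open>\<Prod> (x - \<theta>)\<close> annihilates \<open>e\<^sub>u\<close> and has rational coefficients, so
  \<open>\<Sum> (\<theta> - \<theta>')\<^sup>2\<close> and hence \<open>s\<^sup>2\<close> are rational. Each \<open>(\<theta> - k)\<^sup>2 = s\<^sup>2 m\<^sub>\<theta>\<^sup>2\<close> is a rational
  algebraic integer, hence an integer, and \<open>g = 1\<close> makes \<open>s\<^sup>2\<close> an integer.

  It remains to exclude \<open>s = 1\<close>. Then all \<open>\<theta>\<close> are integers, and those with \<open>c\<^sub>\<theta> = 1\<close> differ in
  parity from those with \<open>c\<^sub>\<theta> = -1\<close>. Modulo 2 the polynomials \<open>P\<^sub>\<plusminus> = \<Prod> (x - \<theta>)\<close> over these two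
  classes are coprime, but they annihilate \<open>e\<^sub>u + e\<^sub>v\<close> and \<open>e\<^sub>u - e\<^sub>v\<close>, which agree modulo 2 and
  are nonzero there. Therefore \<open>s\<^sup>2 \<ge> 2\<close>.
\<close>

subsection \<open>Self-adjoint operators\<close>

text \<open>A maximiser \<open>x\<close> of the Rayleigh quotient on the unit sphere of
  \<open>V\<close> is an eigenvector: the form \<open>q\<close> is nonnegative on \<open>V\<close>
  and vanishes at \<open>x\<close>, so its first variation along the residual \<open>z\<close> must
  be zero.\<close>

lemma selfadjoint_eigenvector_exists:
  fixes f :: "'a::euclidean_space \<Rightarrow> 'a"
  assumes lin: "linear f" and sym: "\<And>x y. f x \<bullet> y = x \<bullet> f y"
    and V: "subspace V" "f ` V \<subseteq> V" "V \<noteq> {0}"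
  shows "\<exists>x\<in>V. \<exists>l. x \<noteq> 0 \<and> f x = l *\<^sub>R x"
proof -
  let ?K = "sphere 0 1 \<inter> V"
  obtain y0 where y0: "y0 \<in> V" "y0 \<noteq> 0"
    using V subspace_0 by blast
  then have "y0 /\<^sub>R norm y0 \<in> ?K"
    using V(1) by (simp add: subspace_scale)
  then have ne: "?K \<noteq> {}" by blast
  have comp: "compact ?K"
    using V(1) by (simp add: closed_subspace compact_Int_closed)
  have cont: "continuous_on ?K (\<lambda>x. f x \<bullet> x)"
    using lin by (intro continuous_on_inner linear_continuous_on continuous_on_id)
      (simp add: linear_conv_bounded_linear)
  obtain x where x: "x \<in> ?K" and mx: "\<And>y. y \<in> ?K \<Longrightarrow> f y \<bullet> y \<le> f x \<bullet> x"
    using continuous_attains_sup[OF comp ne cont] by blast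
  define l where "l = f x \<bullet> x"
  define q where "q y = l * (y \<bullet> y) - f y \<bullet> y" for y
  have xV: "x \<in> V" and xx: "x \<bullet> x = 1"
    using x by (auto simp: norm_eq_1)
  have q_nonneg: "q y \<ge> 0" if "y \<in> V" for y
  proof (cases "y = 0")
    case False
    have "y /\<^sub>R norm y \<in> ?K"
      using that V(1) False by (simp add: subspace_scale)
    from mx[OF this] have "f y \<bullet> y / (norm y)\<^sup>2 \<le> l"
      unfolding l_def by (simp add: linear_scale[OF lin] power2_eq_square divide_simps)
    then show ?thesis
      using False by (simp add: q_def field_simps dot_square_norm)
  qed (simp add: q_def)
  define z where "z = l *\<^sub>R x - f x"
  have zV: "z \<in> V"
    using V xV unfolding z_def by (intro subspace_diff subspace_scale) auto
  have q_exp: "q (x + r *\<^sub>R z) = 2 * r * (z \<bullet> z) + r\<^sup>2 * q z" for r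
  proof -
    have "f z \<bullet> x = z \<bullet> f x" by (rule sym)
    then show ?thesis
      by (simp add: q_def linear_add[OF lin] linear_scale[OF lin] inner_simps xx
          l_def[symmetric] power2_eq_square)
        (simp add: z_def inner_simps inner_commute algebra_simps)
  qed
  have ineq: "2 * r * (z \<bullet> z) + r\<^sup>2 * q z \<ge> 0" for r
    using q_nonneg[of "x + r *\<^sub>R z"] V(1) xV zV
    by (simp only: q_exp subspace_add subspace_scale)
  have "z \<bullet> z = 0"
  proof (rule ccontr)
    assume "z \<bullet> z \<noteq> 0"
    then have pos: "z \<bullet> z > 0" by simp
    \<comment> \<open>A small negative step that would make the quadratic in \<open>ineq\<close>
      negative. The summand 1 keeps the denominator positive even when
      \<open>q z = 0\<close>.\<close>
    define r where "r = - (z \<bullet> z) / (1 + q z)"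
    have q1: "1 + q z > 0" using q_nonneg[OF zV] by simp
    have "r\<^sup>2 * q z \<le> r\<^sup>2 * (1 + q z)"
      by (intro mult_left_mono) auto
    also have "\<dots> = - r * (z \<bullet> z)"
      using q1 by (simp add: r_def power2_eq_square)
    finally have "r * (z \<bullet> z) \<ge> 0" using ineq[of r] by linarith
    moreover have "r < 0" using pos q1 by (simp add: r_def divide_simps)
    ultimately show False using pos by (simp add: zero_le_mult_iff)
  qed
  then have "f x = l *\<^sub>R x" by (simp add: z_def)
  moreover have "x \<noteq> 0" using xx by auto
  ultimately show ?thesis using xV by blast
qed

text \<open>The orthogonal complement of all eigenvectors is invariant; were it nonzero, it would
  contain an eigenvector orthogonal to itself.\<close>

lemma selfadjoint_span_eigenvectors:
  fixes f :: "'a::euclidean_space \<Rightarrow> 'a"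
  assumes lin: "linear f" and sym: "\<And>x y. f x \<bullet> y = x \<bullet> f y"
  shows "span {x. \<exists>l. f x = l *\<^sub>R x} = UNIV"
proof (rule ccontr)
  let ?W = "{x. \<exists>l. f x = l *\<^sub>R x}"
  let ?V = "{y. \<forall>x\<in>?W. orthogonal x y}"
  assume "span ?W \<noteq> UNIV"
  then have "span ?W \<subset> UNIV" by blast
  then obtain a where a: "a \<noteq> 0" "\<And>y. y \<in> span ?W \<Longrightarrow> orthogonal a y"
    using orthogonal_to_subspace_exists_gen[of ?W UNIV] by (auto simp: span_UNIV)
  have "a \<in> ?V" using a(2) by (auto simp: orthogonal_commute intro: span_base)
  then have "?V \<noteq> {0}" using a(1) by blast
  moreover have "subspace ?V" by (rule subspace_orthogonal_to_vectors)
  moreover have "f ` ?V \<subseteq> ?V"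
    by (auto simp: orthogonal_def sym[symmetric])
  ultimately obtain x where "x \<in> ?V" "x \<noteq> 0" "x \<in> ?W"
    using selfadjoint_eigenvector_exists[OF lin sym, of ?V] by auto
  then show False by (auto simp: orthogonal_def)
qed

text \<open>Summands are indexed by their eigenvalue. Making \<open>w\<close> total and zero outside
  \<open>S\<close> allows \<open>S\<close> to be enlarged, so that two expansions can later share
  one index set.\<close>

lemma selfadjoint_decomposition:
  fixes f :: "'a::euclidean_space \<Rightarrow> 'a"
  assumes lin: "linear f" and sym: "\<And>x y. f x \<bullet> y = x \<bullet> f y"
  obtains S w where "finite S" "x = (\<Sum>l\<in>S. w l)" "\<And>l. f (w l) = l *\<^sub>R w l"
    "\<And>l. l \<notin> S \<Longrightarrow> w l = 0"
proof -
  define P where "P x \<longleftrightarrow> (\<exists>S w. finite S \<and> x = (\<Sum>l\<in>S. w l) \<and>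
    (\<forall>l. f (w l) = l *\<^sub>R w l) \<and> (\<forall>l. l \<notin> S \<longrightarrow> w l = 0))" for x
  have "P x"
  proof (rule span_induct_alt[of x "{x. \<exists>l. f x = l *\<^sub>R x}"])
    show "x \<in> span {x. \<exists>l. f x = l *\<^sub>R x}"
      using selfadjoint_span_eigenvectors[OF lin sym] by simp
    show "P 0"
      unfolding P_def
      by (intro exI[of _ "{}"] exI[of _ "\<lambda>_. 0"]) (simp add: linear_0[OF lin])
  next
    fix c y z
    assume "y \<in> {x. \<exists>l. f x = l *\<^sub>R x}" "P z"
    then obtain l S w where l: "f y = l *\<^sub>R y" and S: "finite S" "z = (\<Sum>l\<in>S. w l)"
      "\<And>l. f (w l) = l *\<^sub>R w l" "\<And>l. l \<notin> S \<Longrightarrow> w l = 0"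
      unfolding P_def by blast
    \<comment> \<open>The new eigenvector is merged into the component of its own eigenvalue
      \<open>l\<close>, whether or not \<open>l\<close> already lies in \<open>S\<close>.\<close>
    define w' where "w' k = (if k = l then c *\<^sub>R y else 0) + w k" for k
    have "(\<Sum>k\<in>insert l S. w k) = z"
      unfolding S(2) using S(1,4) by (intro sum.mono_neutral_right) auto
    then have "c *\<^sub>R y + z = (\<Sum>k\<in>insert l S. w' k)"
      using S(1) by (simp add: w'_def sum.distrib sum.delta)
    moreover have "f (w' k) = k *\<^sub>R w' k" for k
      using l S(3) by (simp add: w'_def linear_0[OF lin] linear_add[OF lin] linear_scale[OF lin] algebra_simps)
    moreover have "w' k = 0" if "k \<notin> insert l S" for k
      using that S(4) by (simp add: w'_def)
    ultimately show "P (c *\<^sub>R y + z)"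
      unfolding P_def using S(1) by (intro exI[of _ "insert l S"] exI[of _ w']) auto
  qed
  then show thesis unfolding P_def using that by blast
qed

text \<open>Components for different eigenvalues are orthogonal, so pairing the vanishing sum with
  \<open>w k\<close> isolates \<open>w k \<bullet> w k\<close>.\<close>

lemma selfadjoint_eigenvectors_independent:
  fixes f :: "'a::real_inner \<Rightarrow> 'a"
  assumes sym: "\<And>x y. f x \<bullet> y = x \<bullet> f y"
    and fin: "finite S" and eig: "\<And>l. l \<in> S \<Longrightarrow> f (w l) = l *\<^sub>R w l"
    and sum0: "(\<Sum>l\<in>S. w l) = 0" and k: "k \<in> S"
  shows "w k = 0"
proof -
  have orth: "w k \<bullet> w l = 0" if "l \<in> S" "l \<noteq> k" for l
    using sym[of "w k" "w l"] eig[OF k] eig[OF that(1)] that(2) by auto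
  have "0 = w k \<bullet> (\<Sum>l\<in>S. w l)" by (simp add: sum0)
  also have "\<dots> = (\<Sum>l\<in>S. if l = k then w k \<bullet> w k else 0)"
    unfolding inner_sum_right by (intro sum.cong) (auto simp: orth)
  also have "\<dots> = w k \<bullet> w k" using fin k by simp
  finally show ?thesis by simp
qed

subsection \<open>Rational stabilizers of lattices\<close>

text \<open>
  Such a functional, a coordinate with respect to a rational Hamel basis of the reals, replaces Galois
  theory: it fixes rational data and makes real relations rational.
\<close>

lemma rat_functional_exists:
  obtains f :: "real \<Rightarrow> real" where "\<And>(g :: 'i \<Rightarrow> real) I. f (\<Sum>i\<in>I. g i) = (\<Sum>i\<in>I. f (g i))"
    "\<And>q x. q \<in> \<rat> \<Longrightarrow> f (q * x) = q * f x" "\<And>x. f x \<in> \<rat>" "f 1 = 1"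
proof -
  interpret V: vector_space "\<lambda>(q::rat) (x::real). of_rat q * x"
    by unfold_locales (simp_all add: algebra_simps of_rat_add of_rat_mult)
  define B where "B = V.extend_basis {1}"
  have ind1: "V.independent {1}"
    by simp
  have B: "V.independent B" "1 \<in> B" "V.span B = UNIV"
    using V.independent_extend_basis[OF ind1] V.extend_basis_superset[OF ind1]
      V.span_extend_basis[OF ind1] by (auto simp: B_def)
  define f :: "real \<Rightarrow> real" where "f x = of_rat (V.representation B x 1)" for x
  have "Modules.additive f"
    using V.representation_add[OF B(1)] B(3) by unfold_locales (simp add: f_def of_rat_add)
  then have "f (\<Sum>i\<in>I. g i) = (\<Sum>i\<in>I. f (g i))" for g :: "'i \<Rightarrow> real" and I
    by (rule Modules.additive.sum)
  moreover have "f (q * x) = q * f x" if "q \<in> \<rat>" for q x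
    using that V.representation_scale[OF B(1)] B(3)
    by (auto simp: f_def of_rat_mult elim!: Rats_cases)
  moreover have "f x \<in> \<rat>" for x by (simp add: f_def)
  moreover have "f 1 = 1"
    using V.representation_basis[OF B(1,2)] by (simp add: f_def)
  ultimately show thesis using that by blast
qed

text \<open>Every power of the reduced denominator \<open>q\<close> of \<open>y\<close> divides the
  fixed nonzero \<open>D\<close>, which forces \<open>q = 1\<close>.\<close>

lemma int_multiples_of_powers_imp_Ints:
  fixes y :: real
  assumes y: "y \<in> \<rat>" and D: "D \<noteq> 0" and pow: "\<And>k. of_int D * y ^ k \<in> \<int>"
  shows "y \<in> \<int>"
proof -
  obtain p q :: int where q: "q > 0" "coprime p q" "y = of_int p / of_int q"
    using y by (metis Rats_cases' of_int_eq_iff)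
  have dvd: "q ^ k dvd D" for k
  proof -
    obtain z where z: "of_int D * y ^ k = of_int z" using pow Ints_cases by metis
    then have "of_int (D * p ^ k) = (of_int (z * q ^ k) :: real)"
      using q by (simp add: field_simps)
    then have "D * p ^ k = z * q ^ k" using of_int_eq_iff by blast
    then have "q ^ k dvd D * p ^ k" by simp
    moreover have "coprime (q ^ k) (p ^ k)" using q(2) by (simp add: coprime_commute)
    ultimately show ?thesis using coprime_dvd_mult_left_iff by blast
  qed
  have "q = 1"
  proof (rule ccontr)
    assume "q \<noteq> 1"
    then have "q \<ge> 2" using q(1) by simp
    then have "\<bar>D\<bar> < q ^ nat \<bar>D\<bar>"
      using power_mono[of 2 q "nat \<bar>D\<bar>"] of_nat_less_two_power[of "nat \<bar>D\<bar>", where 'a=int]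
      by (smt (verit) abs_ge_zero int_nat_eq)
    with dvd_imp_le_int[OF D dvd[of "nat \<bar>D\<bar>"]] q(1) show False by simp
  qed
  then show ?thesis using q(3) by simp
qed

lemma common_denominator:
  fixes x :: "'i::finite \<Rightarrow> real"
  assumes "\<And>i. x i \<in> \<rat>"
  obtains D :: int where "D \<noteq> 0" "\<And>i. of_int D * x i \<in> \<int>"
proof -
  have "\<exists>q::int. q \<noteq> 0 \<and> of_int q * x i \<in> \<int>" for i
  proof -
    obtain p q :: int where "q > 0" "x i = of_int p / of_int q"
      using assms[of i] by (metis Rats_cases')
    then show ?thesis by (intro exI[of _ q]) auto
  qed
  then obtain q :: "'i \<Rightarrow> int" where q: "\<And>i. q i \<noteq> 0" "\<And>i. of_int (q i) * x i \<in> \<int>"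
    by metis
  have "of_int (\<Prod>j\<in>UNIV. q j) * x i \<in> \<int>" for i
  proof -
    have "of_int (\<Prod>j\<in>UNIV. q j) * x i = of_int (\<Prod>j\<in>UNIV - {i}. q j) * (of_int (q i) * x i)"
      by (subst prod.remove[of UNIV i]) auto
    then show ?thesis using q(2) by (metis Ints_mult Ints_of_int)
  qed
  moreover have "(\<Prod>j\<in>UNIV. q j) \<noteq> 0" using q(1) by simp
  ultimately show thesis using that by blast
qed

text \<open>A finitely generated additive group of reals, whose generators may be dependent. It
  serves the module criterion for algebraic integers: a number that multiplies such a nonzero group
  into itself is integral.\<close>

definition int_span :: "('i::finite \<Rightarrow> real) \<Rightarrow> real set" where
  "int_span r = range (\<lambda>b. \<Sum>j\<in>UNIV. of_int (b j) * r j)"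

lemma int_span_base: "r i \<in> int_span r"
  unfolding int_span_def
  by (rule image_eqI[of _ _ "\<lambda>j. if j = i then 1 else 0"])
    (auto simp: if_distrib[of "\<lambda>x. of_int x * _"] cong: if_cong)

lemma int_span_zero: "0 \<in> int_span r"
  unfolding int_span_def by (rule image_eqI[of _ _ "\<lambda>j. 0"]) auto

lemma int_span_add: "x \<in> int_span r \<Longrightarrow> y \<in> int_span r \<Longrightarrow> x + y \<in> int_span r"
  unfolding int_span_def
  by (auto intro!: image_eqI[of _ _ "\<lambda>j. _ j + _ j"] simp: algebra_simps sum.distrib)

lemma int_span_scale: "c \<in> \<int> \<Longrightarrow> x \<in> int_span r \<Longrightarrow> c * x \<in> int_span r"
  unfolding int_span_def
  by (auto intro!: image_eqI[of _ _ "\<lambda>j. _ * _ j"] simp: sum_distrib_left mult.assoc elim!: Ints_cases)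

lemma int_span_diff: "x \<in> int_span r \<Longrightarrow> y \<in> int_span r \<Longrightarrow> x - y \<in> int_span r"
  using int_span_add[of x r "- 1 * y"] int_span_scale[of "- 1" y r] by simp

lemma int_span_sum: "(\<And>i. i \<in> I \<Longrightarrow> g i \<in> int_span r) \<Longrightarrow> (\<Sum>i\<in>I. g i) \<in> int_span r"
  by (induction I rule: infinite_finite_induct) (auto intro: int_span_zero int_span_add)

lemma int_span_stable:
  assumes "\<And>i. y * r i \<in> int_span r" and "x \<in> int_span r"
  shows "y * x \<in> int_span r"
proof -
  obtain b :: "'a \<Rightarrow> int" where "x = (\<Sum>j\<in>UNIV. of_int (b j) * r j)"
    using assms(2) by (auto simp: int_span_def)
  then have "y * x = (\<Sum>j\<in>UNIV. of_int (b j) * (y * r j))"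
    by (simp add: sum_distrib_left mult.left_commute)
  also have "\<dots> \<in> int_span r"
    by (intro int_span_sum int_span_scale assms(1)) simp
  finally show ?thesis .
qed

text \<open>All \<open>y ^ k * r a\<close> stay in the group. Dividing by \<open>r a\<close> and
  applying the rational functional, which fixes the rational \<open>y ^ k\<close>, expresses the
  powers as integer combinations of finitely many rationals, so they have a common
  denominator.\<close>

lemma rational_int_span_stabilizer_is_int:
  assumes y: "y \<in> \<rat>" and ra: "r a \<noteq> 0" and stable: "\<And>i. y * r i \<in> int_span r"
  shows "y \<in> \<int>"
proof -
  obtain f :: "real \<Rightarrow> real" where f:
    "\<And>(g::'a \<Rightarrow> real) I. f (\<Sum>i\<in>I. g i) = (\<Sum>i\<in>I. f (g i))"
    "\<And>q x. q \<in> \<rat> \<Longrightarrow> f (q * x) = q * f x" "\<And>x. f x \<in> \<rat>" "f 1 = 1"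
    using rat_functional_exists by metis
  obtain D :: int where D: "D \<noteq> 0" "\<And>i. of_int D * f (r i / r a) \<in> \<int>"
    using common_denominator[of "\<lambda>i. f (r i / r a)"] f(3) by blast
  have "of_int D * y ^ k \<in> \<int>" for k
  proof -
    have "y ^ k * r a \<in> int_span r"
      by (induction k) (simp_all add: int_span_base int_span_stable[OF stable] mult.assoc)
    then obtain b :: "'a \<Rightarrow> int" where b: "y ^ k * r a = (\<Sum>j\<in>UNIV. of_int (b j) * r j)"
      by (auto simp: int_span_def)
    have "y ^ k = f (y ^ k * 1)" using f(2)[of "y ^ k" 1] f(4) y by simp
    also have "y ^ k * 1 = (\<Sum>j\<in>UNIV. of_int (b j) * (r j / r a))"
      using b ra by (simp add: field_simps sum_divide_distrib[symmetric])
    also have "f \<dots> = (\<Sum>j\<in>UNIV. of_int (b j) * f (r j / r a))"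
      by (simp add: f(1,2) del: times_divide_eq_right)
    finally have "of_int D * y ^ k = (\<Sum>j\<in>UNIV. of_int (b j) * (of_int D * f (r j / r a)))"
      by (simp add: sum_distrib_left mult.left_commute)
    then show ?thesis using D(2) by auto
  qed
  with y D(1) show ?thesis by (rule int_multiples_of_powers_imp_Ints)
qed

text \<open>The eigenvalue equation, read coordinatewise, says that \<open>l\<close> stabilizes the
  group generated by the entries of \<open>w\<close>.\<close>

lemma rational_eigenvalue_is_int:
  fixes A :: "real^'n^'n"
  assumes A: "\<And>i j. A $ i $ j \<in> \<int>" and w: "A *v w = l *\<^sub>R w" "w \<noteq> 0" and l: "l \<in> \<rat>"
  shows "l \<in> \<int>"
proof -
  obtain a where a: "w $ a \<noteq> 0" using w(2) by (auto simp: vec_eq_iff)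
  show ?thesis
  proof (rule rational_int_span_stabilizer_is_int[where r = "\<lambda>i. w $ i", OF l a])
    fix i
    have "l * w $ i = (A *v w) $ i" by (simp add: w(1))
    then show "l * w $ i \<in> int_span (($) w)"
      using A by (auto simp: matrix_vector_mult_def intro!: int_span_sum int_span_scale int_span_base)
  qed
qed

text \<open>The products \<open>w $ i * z $ j\<close> are the entries of an eigenvector of the
  integer matrix A (x) I - I (x) A with eigenvalue \<open>l - k\<close>. Hence \<open>l - k\<close>,
  and so its square, stabilizes the group they generate.\<close>

lemma rational_square_eigenvalue_diff_is_int:
  fixes A :: "real^'n^'n"
  assumes A: "\<And>i j. A $ i $ j \<in> \<int>" and w: "A *v w = l *\<^sub>R w" "w \<noteq> 0"
    and z: "A *v z = k *\<^sub>R z" "z \<noteq> 0" and l: "(l - k)\<^sup>2 \<in> \<rat>"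
  shows "(l - k)\<^sup>2 \<in> \<int>"
proof -
  obtain a where a: "w $ a \<noteq> 0" using w(2) by (auto simp: vec_eq_iff)
  obtain b where b: "z $ b \<noteq> 0" using z(2) by (auto simp: vec_eq_iff)
  define r where "r = (\<lambda>(i, j). w $ i * z $ j)"
  have step: "(l - k) * r p \<in> int_span r" for p
  proof -
    obtain i j where p: "p = (i, j)" by fastforce
    have "(l - k) * r p = (A *v w) $ i * z $ j - w $ i * (A *v z) $ j"
      by (simp add: p r_def w(1) z(1) algebra_simps)
    also have "\<dots> = (\<Sum>c\<in>UNIV. A $ i $ c * r (c, j)) - (\<Sum>c\<in>UNIV. A $ j $ c * r (i, c))"
      by (simp add: matrix_vector_mult_def r_def sum_distrib_left sum_distrib_right mult_ac)
    also have "\<dots> \<in> int_span r"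
      by (intro int_span_diff int_span_sum int_span_scale int_span_base A)
    finally show ?thesis .
  qed
  show ?thesis
  proof (rule rational_int_span_stabilizer_is_int[where r = r and a = "(a, b)", OF l])
    show "r (a, b) \<noteq> 0" using a b by (simp add: r_def)
    show "(l - k)\<^sup>2 * r i \<in> int_span r" for i
      using int_span_stable[OF step step] by (simp add: power2_eq_square mult.assoc)
  qed
qed

subsection \<open>The support of an integer vector\<close>

lemma matrix_power_eigenvector_sum:
  fixes A :: "real^'n^'n"
  assumes "\<And>i. i \<in> I \<Longrightarrow> A *v w i = l i *\<^sub>R w i"
  shows "((*v) A ^^ k) (\<Sum>i\<in>I. w i) = (\<Sum>i\<in>I. l i ^ k *\<^sub>R w i)"
proof (induction k)
  case (Suc k)
  have "A *v (\<Sum>i\<in>I. l i ^ k *\<^sub>R w i) = (\<Sum>i\<in>I. l i ^ k *\<^sub>R (A *v w i))"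
    by (simp add: linear_sum linear_scale o_def)
  then show ?case
    using Suc assms by (simp add: mult.commute cong: sum.cong)
qed simp

lemma matrix_poly_eigenvector_sum:
  fixes A :: "real^'n^'n" and p :: "real poly"
  assumes "\<And>i. i \<in> I \<Longrightarrow> A *v w i = l i *\<^sub>R w i"
  shows "(\<Sum>k\<le>degree p. coeff p k *\<^sub>R ((*v) A ^^ k) (\<Sum>i\<in>I. w i)) = (\<Sum>i\<in>I. poly p (l i) *\<^sub>R w i)"
  by (simp add: matrix_power_eigenvector_sum[OF assms] poly_altdef scaleR_sum_right
      scaleR_sum_left sum.swap[of _ I])

lemma matrix_power_Ints:
  fixes A :: "real^'n^'n"
  assumes "\<And>i j. A $ i $ j \<in> \<int>" "\<And>i. e $ i \<in> \<int>"
  shows "((*v) A ^^ k) e $ i \<in> \<int>"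
  by (induction k arbitrary: i) (auto simp: assms matrix_vector_mult_def intro!: Ints_sum Ints_mult)

lemma symmetric_matrix_inner:
  fixes A :: "real^'n^'n"
  assumes "transpose A = A"
  shows "(A *v x) \<bullet> y = x \<bullet> (A *v y)"
  using dot_lmul_matrix[of x A y] vector_transpose_matrix[of x A] assms by simp

text \<open>\<open>P\<close> is the monic polynomial of least degree annihilating the integer vector
  \<open>e\<close>. Applying the functional \<open>f\<close> to its coefficients keeps it monic of
  the same degree and, as the iterates of \<open>e\<close> are integral, keeps the annihilation.
  Thus \<open>f\<close> fixes every coefficient.\<close>

lemma support_poly_rational:
  fixes A :: "real^'n^'n"
  assumes A: "\<And>i j. A $ i $ j \<in> \<int>" "transpose A = A" and e: "\<And>i. (\<Sum>l\<in>T. w l) $ i \<in> \<int>"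
    and T: "finite T" and eig: "\<And>l. l \<in> T \<Longrightarrow> A *v w l = l *\<^sub>R w l"
    and nz: "\<And>l. l \<in> T \<Longrightarrow> w l \<noteq> 0"
  shows "coeff (\<Prod>l\<in>T. [:- l, 1:]) k \<in> \<rat>"
proof -
  define P :: "real poly" where "P = (\<Prod>l\<in>T. [:- l, 1:])"
  define e where "e = (\<Sum>l\<in>T. w l)"
  have degP: "degree P = card T"
    unfolding P_def by (subst degree_prod_sum_eq) (auto simp: T)
  have monic: "coeff P (card T) = 1"
    using lead_coeff_prod[of "\<lambda>l. [:- l, 1:]" T] by (simp add: degP[symmetric] P_def)
  have rootP: "poly P l = 0" if "l \<in> T" for l
    using that T by (auto simp: P_def poly_prod)
  obtain f :: "real \<Rightarrow> real" where f:
    "\<And>(g::nat \<Rightarrow> real) I. f (\<Sum>i\<in>I. g i) = (\<Sum>i\<in>I. f (g i))"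
    "\<And>q x. q \<in> \<rat> \<Longrightarrow> f (q * x) = q * f x" "\<And>x. f x \<in> \<rat>" "f 1 = 1"
    using rat_functional_exists by metis
  have f0: "f 0 = 0" using f(2)[of 0 0] by simp
  define P' where "P' = map_poly f P"
  have coeffP': "coeff P' k = f (coeff P k)" for k
    by (simp add: P'_def coeff_map_poly f0)
  have degP': "degree P' = card T"
  proof (rule antisym)
    show "degree P' \<le> card T"
      by (rule degree_le) (simp add: coeffP' coeff_eq_0 degP f0)
    show "card T \<le> degree P'" by (rule le_degree) (simp add: coeffP' monic f(4))
  qed
  have "(\<Sum>k\<le>card T. coeff P' k *\<^sub>R ((*v) A ^^ k) e) = 0"
  proof (rule vec_eq_iff[THEN iffD2], rule allI)
    fix i
    have q: "((*v) A ^^ k) e $ i \<in> \<rat>" for k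
      using matrix_power_Ints[of A e k i] A(1) e by (auto simp: e_def Ints_subset_Rats[THEN subsetD])
    have "(\<Sum>k\<le>card T. coeff P k *\<^sub>R ((*v) A ^^ k) e) = 0"
      using matrix_poly_eigenvector_sum[of T A w "\<lambda>l. l" P] eig rootP
      by (simp add: degP e_def)
    then have "0 = (\<Sum>k\<le>card T. coeff P k *\<^sub>R ((*v) A ^^ k) e) $ i" by simp
    also have "\<dots> = (\<Sum>k\<le>card T. ((*v) A ^^ k) e $ i * coeff P k)"
      by (simp add: mult.commute)
    finally have "f 0 = f (\<Sum>k\<le>card T. ((*v) A ^^ k) e $ i * coeff P k)" by simp
    also have "\<dots> = (\<Sum>k\<le>card T. ((*v) A ^^ k) e $ i * coeff P' k)"
      by (simp add: f(1) f(2)[OF q] coeffP')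
    finally show "(\<Sum>k\<le>card T. coeff P' k *\<^sub>R ((*v) A ^^ k) e) $ i = 0 $ i"
      by (simp add: f0 mult.commute)
  qed
  then have sum0: "(\<Sum>l\<in>T. poly P' l *\<^sub>R w l) = 0"
    using matrix_poly_eigenvector_sum[of T A w "\<lambda>l. l" P'] eig by (simp add: degP' e_def)
  have rootP': "poly P' l = 0" if l: "l \<in> T" for l
  proof -
    have "poly P' l *\<^sub>R w l = 0"
      using selfadjoint_eigenvectors_independent[of "(*v) A" T "\<lambda>l. poly P' l *\<^sub>R w l",
          OF symmetric_matrix_inner[OF A(2)] T _ sum0 l] eig
      by (simp add: linear_scale mult.commute)
    then show ?thesis using nz[OF l] by simp
  qed
  \<comment> \<open>Both are monic of degree \<open>card T\<close> and vanish at the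
    \<open>card T\<close> points of \<open>T\<close>.\<close>
  have "P' = P"
    by (rule poly_eqI_degree_lead_coeff[where n = "card T" and A = T])
      (simp_all add: coeffP' monic f(4) degP degP' rootP rootP')
  then show ?thesis using f(3) coeffP' unfolding P_def by metis
qed

text \<open>In the reversed product the first two elementary symmetric functions sit at positions 1
  and 2 whatever the size of \<open>T\<close>; the last claim is Newton's identity.\<close>

lemma coeff_prod_one_minus:
  fixes T :: "'a::comm_ring_1 set"
  assumes "finite T"
  shows "coeff (\<Prod>l\<in>T. [:1, - l:]) 0 = 1"
    and "coeff (\<Prod>l\<in>T. [:1, - l:]) 1 = - (\<Sum>l\<in>T. l)"
    and "2 * coeff (\<Prod>l\<in>T. [:1, - l:]) 2 = (\<Sum>l\<in>T. l)\<^sup>2 - (\<Sum>l\<in>T. l\<^sup>2)"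
proof -
  have "coeff (\<Prod>l\<in>T. [:1, - l:]) 0 = 1 \<and>
    coeff (\<Prod>l\<in>T. [:1, - l:]) (Suc 0) = - (\<Sum>l\<in>T. l) \<and>
    2 * coeff (\<Prod>l\<in>T. [:1, - l:]) (Suc (Suc 0)) = (\<Sum>l\<in>T. l)\<^sup>2 - (\<Sum>l\<in>T. l\<^sup>2)"
    using assms
  proof (induction T rule: finite_induct)
    case (insert a T)
    then show ?case
      by (simp add: power2_sum algebra_simps power2_eq_square)
  qed simp
  then show "coeff (\<Prod>l\<in>T. [:1, - l:]) 0 = 1"
    and "coeff (\<Prod>l\<in>T. [:1, - l:]) 1 = - (\<Sum>l\<in>T. l)"
    and "2 * coeff (\<Prod>l\<in>T. [:1, - l:]) 2 = (\<Sum>l\<in>T. l)\<^sup>2 - (\<Sum>l\<in>T. l\<^sup>2)"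
    by (simp_all add: numeral_2_eq_2)
qed

lemma power_sums_rational:
  fixes T :: "real set"
  assumes T: "finite T" and rat: "\<And>k. coeff (\<Prod>l\<in>T. [:- l, 1:]) k \<in> \<rat>"
  shows "(\<Sum>l\<in>T. l) \<in> \<rat>" "(\<Sum>l\<in>T. l\<^sup>2) \<in> \<rat>"
proof -
  have "reflect_poly [:- l, 1:] = [:1, - l:]" for l :: real
    by (rule poly_eqI) (auto simp: coeff_reflect_poly coeff_pCons split: nat.splits)
  then have "(\<Prod>l\<in>T. [:1, - l:]) = reflect_poly (\<Prod>l\<in>T. [:- l, 1:])"
    by (simp add: reflect_poly_prod)
  then have rat': "coeff (\<Prod>l\<in>T. [:1, - l:]) k \<in> \<rat>" for k
    using rat by (simp add: coeff_reflect_poly)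
  from rat'[of 1] show p1: "(\<Sum>l\<in>T. l) \<in> \<rat>"
    unfolding coeff_prod_one_minus[OF T] by simp
  have "(\<Sum>l\<in>T. l\<^sup>2) = (\<Sum>l\<in>T. l)\<^sup>2 - 2 * coeff (\<Prod>l\<in>T. [:1, - l:]) 2"
    unfolding coeff_prod_one_minus[OF T] by simp
  then show "(\<Sum>l\<in>T. l\<^sup>2) \<in> \<rat>" using p1 rat'[of 2] by simp
qed

text \<open>The sum of \<open>(l - k)\<^sup>2\<close> over all ordered pairs is
  \<open>s\<^sup>2\<close> times a positive integer, and it is also a rational expression in the two
  power sums.\<close>

lemma square_of_common_step_rational:
  fixes T :: "real set" and m :: "real \<Rightarrow> int"
  assumes T: "finite T" "(\<Sum>l\<in>T. l) \<in> \<rat>" "(\<Sum>l\<in>T. l\<^sup>2) \<in> \<rat>"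
    and step: "\<And>l k. l \<in> T \<Longrightarrow> k \<in> T \<Longrightarrow> l - k = s * of_int (m l - m k)"
    and ab: "a \<in> T" "b \<in> T" "m a \<noteq> m b"
  shows "s\<^sup>2 \<in> \<rat>"
proof -
  define M where "M = (\<Sum>l\<in>T. \<Sum>k\<in>T. (m l - m k)\<^sup>2)"
  have pos: "(\<Sum>k\<in>T. (m a - m k)\<^sup>2) > 0"
    using T(1) ab by (intro sum_pos2[of T b]) auto
  have "M > 0"
    unfolding M_def using T(1) ab(1) by (rule sum_pos2) (auto intro: pos sum_nonneg)
  have "(\<Sum>l\<in>T. \<Sum>k\<in>T. (l - k)\<^sup>2) = (\<Sum>l\<in>T. \<Sum>k\<in>T. s\<^sup>2 * of_int ((m l - m k)\<^sup>2))"
    by (intro sum.cong refl) (simp add: step power_mult_distrib)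
  also have "\<dots> = s\<^sup>2 * of_int M"
    by (simp add: M_def sum_distrib_left)
  finally have "s\<^sup>2 = (\<Sum>l\<in>T. \<Sum>k\<in>T. (l - k)\<^sup>2) / of_int M"
    using \<open>M > 0\<close> by simp
  also have "(\<Sum>l\<in>T. \<Sum>k\<in>T. (l - k)\<^sup>2)
      = 2 * of_nat (card T) * (\<Sum>l\<in>T. l\<^sup>2) - 2 * (\<Sum>l\<in>T. l)\<^sup>2"
    by (simp add: power2_diff sum.distrib sum_subtractf sum_distrib_left[symmetric]
        sum_distrib_right[symmetric] power2_eq_square algebra_simps)
      (simp add: sum_distrib_left mult_ac)
  finally show ?thesis using T by simp
qed

text \<open>A prime factor of the reduced denominator of \<open>x\<close> would divide every
  \<open>m l\<close>, hence their gcd.\<close>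

lemma Ints_of_coprime_square_multiples:
  fixes x :: real and m :: "'a \<Rightarrow> int"
  assumes x: "x \<in> \<rat>" and gcd: "Gcd (m ` T) = 1"
    and int: "\<And>l. l \<in> T \<Longrightarrow> x * (of_int (m l))\<^sup>2 \<in> \<int>"
  shows "x \<in> \<int>"
proof -
  obtain p q :: int where q: "q > 0" "coprime p q" "x = of_int p / of_int q"
    using x by (metis Rats_cases' of_int_eq_iff)
  have dvd: "q dvd (m l)\<^sup>2" if l: "l \<in> T" for l
  proof -
    obtain z where "x * (of_int (m l))\<^sup>2 = of_int z" using int[OF l] Ints_cases by metis
    then have "of_int (p * (m l)\<^sup>2) = (of_int (z * q) :: real)"
      using q by (simp add: field_simps)
    then have "p * (m l)\<^sup>2 = z * q" using of_int_eq_iff by blast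
    then have "q dvd p * (m l)\<^sup>2" by simp
    then show ?thesis using q(2) by (metis coprime_commute coprime_dvd_mult_right_iff)
  qed
  have "q = 1"
  proof (rule ccontr)
    assume "q \<noteq> 1"
    then obtain r where r: "prime r" "r dvd q"
      using q(1) prime_divisor_exists[of q] by auto
    then have "r dvd m l" if "l \<in> T" for l
      using dvd[OF that] by (meson dvd_trans prime_dvd_power)
    then have "r dvd Gcd (m ` T)" by (auto intro: Gcd_greatest)
    with gcd r(1) show False by auto
  qed
  then show ?thesis using q(3) by simp
qed

subsection \<open>The parity obstruction\<close>

text \<open>Coprimality modulo 2, witnessed by an integral Bezout identity.\<close>

definition odd_comaximal :: "int poly \<Rightarrow> int poly \<Rightarrow> bool" where
  "odd_comaximal p q \<longleftrightarrow> (\<exists>U V R. odd R \<and> U * p + V * q = [:R:])"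

lemma odd_comaximal_commute: "odd_comaximal p q \<Longrightarrow> odd_comaximal q p"
  unfolding odd_comaximal_def by (metis add.commute)

lemma odd_comaximal_one: "odd_comaximal 1 q"
  unfolding odd_comaximal_def
  by (intro exI[of _ 1] exI[of _ 0]) (simp add: one_pCons)

lemma odd_comaximal_mult:
  assumes "odd_comaximal p q" "odd_comaximal p' q"
  shows "odd_comaximal (p * p') q"
proof -
  obtain U V R U' V' R' where *: "odd R" "U * p + V * q = [:R:]" "odd R'" "U' * p' + V' * q = [:R':]"
    using assms unfolding odd_comaximal_def by blast
  have "(U * U') * (p * p') + (U * p * V' + V * U' * p' + V * V' * q) * q
      = (U * p + V * q) * (U' * p' + V' * q)"
    by (simp add: algebra_simps)
  also have "\<dots> = [:R * R':]" by (simp add: *)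
  finally show ?thesis using *(1,3) unfolding odd_comaximal_def by (metis even_mult_iff)
qed

lemma odd_comaximal_prod:
  assumes "\<And>i. i \<in> I \<Longrightarrow> odd_comaximal (p i) q"
  shows "odd_comaximal (\<Prod>i\<in>I. p i) q"
  using assms
  by (induction I rule: infinite_finite_induct) (auto intro: odd_comaximal_one odd_comaximal_mult)

text \<open>Two monic linear factors differ by the constant \<open>a - b\<close>, which is odd;
  products inherit comaximality.\<close>

lemma odd_comaximal_linear_factors:
  assumes "\<And>a b. a \<in> X \<Longrightarrow> b \<in> Y \<Longrightarrow> odd (a - b)"
  shows "odd_comaximal (\<Prod>a\<in>X. [:- a, 1:]) (\<Prod>b\<in>Y. [:- b, 1:])"
proof (intro odd_comaximal_prod odd_comaximal_commute[OF odd_comaximal_prod])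
  fix a b assume "a \<in> X" "b \<in> Y"
  then have "odd (a - b)" by (rule assms)
  moreover have "1 * [:- b, 1:] + - 1 * [:- a, 1:] = [:a - b:]" by simp
  ultimately show "odd_comaximal [:- b, 1:] [:- a, 1:]"
    unfolding odd_comaximal_def by blast
qed

text \<open>Otherwise the annihilators of the two sign classes satisfy a Bezout identity with odd
  \<open>R\<close>. This gives R (e_u - e_v) = -2 g(A) e_v with g(A) e_v integral, and entry
  \<open>u\<close> makes \<open>R\<close> even.\<close>

lemma integer_spectrum_parity:
  fixes A :: "real^'n^'n" and c :: "int \<Rightarrow> int"
  assumes A: "\<And>i j. A $ i $ j \<in> \<int>" and X: "finite X"
    and eig: "\<And>x. x \<in> X \<Longrightarrow> A *v w x = of_int x *\<^sub>R w x"
    and c: "\<And>x. x \<in> X \<Longrightarrow> c x = 1 \<or> c x = - 1"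
    and u: "axis u 1 = (\<Sum>x\<in>X. w x)" and v: "axis v 1 = (\<Sum>x\<in>X. of_int (c x) *\<^sub>R w x)"
    and "u \<noteq> v"
  shows "\<exists>x\<in>X. \<exists>y\<in>X. c x = 1 \<and> c y = - 1 \<and> even (x - y)"
proof (rule ccontr)
  assume contr: "\<not> ?thesis"
  define P where "P s = (\<Prod>a\<in>{x\<in>X. c x = s}. [:- a, 1:])" for s
  have root: "poly (P (c x)) x = 0" if "x \<in> X" for x
    using that X by (auto simp: P_def poly_prod)
  have "odd_comaximal (P 1) (P (- 1))"
    unfolding P_def using contr by (intro odd_comaximal_linear_factors) blast
  then obtain U V R where R: "odd R" "U * P 1 + V * P (- 1) = [:R:]"
    unfolding odd_comaximal_def by blast
  define g where "g = U * P 1"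
  \<comment> \<open>\<open>g\<close> takes the value 0 where \<open>c x = 1\<close> and
    \<open>R\<close> where \<open>c x = - 1\<close>.\<close>
  have key: "R * (1 - c x) = - 2 * (poly g x * c x)" if x: "x \<in> X" for x
  proof -
    have "R = poly (U * P 1 + V * P (- 1)) x" by (simp add: R(2))
    then show ?thesis using c[OF x] root[OF x] by (auto simp: g_def)
  qed
  define e where "e = (\<Sum>x\<in>X. of_int (c x) *\<^sub>R w x)"
  have e: "e = axis v 1" by (simp add: e_def v)
  have "of_int R *\<^sub>R (axis u 1 - axis v 1) = (\<Sum>x\<in>X. of_int (R * (1 - c x)) *\<^sub>R w x)"
    unfolding u v by (simp add: scaleR_sum_right sum_subtractf[symmetric] algebra_simps)
  also have "\<dots> = - 2 *\<^sub>R (\<Sum>x\<in>X. of_int (poly g x * c x) *\<^sub>R w x)"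
    using key by (simp add: scaleR_sum_right cong: sum.cong)
  also have "(\<Sum>x\<in>X. of_int (poly g x * c x) *\<^sub>R w x)
      = (\<Sum>k\<le>degree g. of_int (coeff g k) *\<^sub>R ((*v) A ^^ k) e)"
  proof -
    have "A *v (of_int (c x) *\<^sub>R w x) = of_int x *\<^sub>R (of_int (c x) *\<^sub>R w x)" if "x \<in> X" for x
      using eig[OF that] by (simp add: linear_scale)
    from matrix_power_eigenvector_sum[of X A "\<lambda>x. of_int (c x) *\<^sub>R w x" of_int, OF this]
    have "((*v) A ^^ k) e = (\<Sum>x\<in>X. of_int x ^ k *\<^sub>R (of_int (c x) *\<^sub>R w x))" for k
      by (simp add: e_def)
    then show ?thesis
      by (simp add: poly_altdef scaleR_sum_right scaleR_sum_left sum_distrib_left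
          sum_distrib_right sum.swap[of _ X] mult_ac)
  qed
  finally have "of_int R *\<^sub>R (axis u 1 - axis v 1) $ u
      = - 2 * (\<Sum>k\<le>degree g. of_int (coeff g k) * ((*v) A ^^ k) e $ u)"
    by (simp add: vec_eq_iff del: axis_nth)
  moreover have "(axis u 1 - axis v 1 :: real^'n) $ u = 1"
    using \<open>u \<noteq> v\<close> by (simp add: axis_def)
  moreover have "(\<Sum>k\<le>degree g. of_int (coeff g k) * ((*v) A ^^ k) e $ u) \<in> \<int>"
    using A by (intro Ints_sum Ints_mult matrix_power_Ints) (auto simp: e axis_def)
  then obtain z where "(\<Sum>k\<le>degree g. of_int (coeff g k) * ((*v) A ^^ k) e $ u) = of_int z"
    using Ints_cases by blast
  ultimately have "(of_int R :: real) = of_int (- 2 * z)" by simp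
  then have "R = - 2 * z" using of_int_eq_iff by blast
  with R(1) show False by simp
qed

subsection \<open>Perfect state transfer\<close>

text \<open>A real copy of the adjacency matrix, to which the spectral decomposition in a Euclidean
  space applies.\<close>

definition real_adj :: "('n::finite \<Rightarrow> 'n \<Rightarrow> bool) \<Rightarrow> real^'n^'n" where
  "real_adj E = (\<chi> i j. if E i j then 1 else 0)"

lemma real_adj_Ints: "real_adj E $ i $ j \<in> \<int>"
  by (simp add: real_adj_def)

lemma transpose_real_adj: "simple_graph E \<Longrightarrow> transpose (real_adj E) = real_adj E"
  by (auto simp: real_adj_def simple_graph_def transpose_def vec_eq_iff)

lemma matrix_times_basis_vec: "(M *v basis_vec u) $ a = M $ a $ u"
  by (simp add: matrix_vector_mult_def basis_vec_def if_distrib cong: if_cong)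

lemma adj_matrix_conv_real_adj: "adj_matrix E $ a $ b = of_real (real_adj E $ a $ b)"
  by (simp add: adj_matrix_def real_adj_def)

lemma mat_pow_scaled_adj:
  "mat_pow (\<chi> a b. z * adj_matrix E $ a $ b) k $ a $ u
    = z ^ k * of_real (((*v) (real_adj E) ^^ k) (axis u 1) $ a)"
proof (induction k arbitrary: a)
  case 0
  show ?case by (simp add: mat_def axis_def)
next
  case (Suc k)
  have "mat_pow (\<chi> a b. z * adj_matrix E $ a $ b) (Suc k) $ a $ u
    = (\<Sum>b\<in>UNIV. z * adj_matrix E $ a $ b * (z ^ k * of_real (((*v) (real_adj E) ^^ k) (axis u 1) $ b)))"
    by (simp add: matrix_matrix_mult_def Suc)
  also have "\<dots> = z ^ Suc k * of_real (\<Sum>b\<in>UNIV. real_adj E $ a $ b * ((*v) (real_adj E) ^^ k) (axis u 1) $ b)"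
    by (simp add: sum_distrib_left adj_matrix_conv_real_adj mult_ac)
  also have "(\<Sum>b\<in>UNIV. real_adj E $ a $ b * ((*v) (real_adj E) ^^ k) (axis u 1) $ b)
    = ((*v) (real_adj E) ^^ Suc k) (axis u 1) $ a"
    by (simp add: matrix_vector_mult_def)
  finally show ?case .
qed

text \<open>On the component of eigenvalue \<open>l\<close> the exponential series converges to
  \<open>cis (t * l)\<close>; a finite sum of such series gives the entry of
  \<open>mat_exp\<close>.\<close>

lemma mat_exp_adj_spectral:
  assumes eig: "\<And>l. l \<in> T \<Longrightarrow> real_adj E *v w l = l *\<^sub>R w l"
    and u: "axis u 1 = (\<Sum>l\<in>T. w l)"
  shows "(mat_exp (\<chi> a b. (\<i> * complex_of_real t) * adj_matrix E $ a $ b) *v basis_vec u) $ a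
    = (\<Sum>l\<in>T. cis (t * l) * of_real (w l $ a))"
proof -
  have pow: "((*v) (real_adj E) ^^ k) (axis u 1) = (\<Sum>l\<in>T. l ^ k *\<^sub>R w l)" for k
    unfolding u by (rule matrix_power_eigenvector_sum) (rule eig)
  have "(\<lambda>k. (\<i> * of_real (t * l)) ^ k /\<^sub>R fact k * of_real (w l $ a))
      sums (cis (t * l) * of_real (w l $ a))" for l
    unfolding cis_conv_exp by (intro sums_mult2 exp_converges)
  then have "(\<lambda>k. \<Sum>l\<in>T. (\<i> * of_real (t * l)) ^ k /\<^sub>R fact k * of_real (w l $ a))
      sums (\<Sum>l\<in>T. cis (t * l) * of_real (w l $ a))"
    by (rule sums_sum)
  also have "(\<lambda>k. \<Sum>l\<in>T. (\<i> * of_real (t * l)) ^ k /\<^sub>R fact k * of_real (w l $ a))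
      = (\<lambda>k. mat_pow (\<chi> a b. (\<i> * complex_of_real t) * adj_matrix E $ a $ b) k $ a $ u / of_nat (fact k))"
    unfolding mat_pow_scaled_adj pow
    by (simp add: sum_distrib_left sum_divide_distrib scaleR_conv_of_real[where 'a = complex] power_mult_distrib field_simps)
  finally show ?thesis
    by (simp add: matrix_times_basis_vec mat_exp_def sums_iff)
qed

lemma PST_spectral_iff:
  assumes "\<And>l. l \<in> T \<Longrightarrow> real_adj E *v w l = l *\<^sub>R w l" "axis u 1 = (\<Sum>l\<in>T. w l)"
  shows "PST E u v t \<longleftrightarrow> u \<noteq> v \<and> t > 0 \<and> (\<exists>\<gamma>. norm \<gamma> = 1 \<and>
    (\<forall>a. (\<Sum>l\<in>T. cis (t * l) * of_real (w l $ a)) = \<gamma> * of_real (axis v 1 $ a)))"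
proof -
  have "(\<gamma> *s basis_vec v) $ a = \<gamma> * of_real (axis v 1 $ a)" for \<gamma> a
    by (simp add: basis_vec_def axis_def)
  moreover have "(mat_exp (\<chi> a b. (\<i> * complex_of_real t) * adj_matrix E $ a $ b) *v basis_vec u) $ a
    = (\<Sum>l\<in>T. cis (t * l) * of_real (w l $ a))" for a
    using assms by (rule mat_exp_adj_spectral)
  ultimately show ?thesis unfolding PST_def vec_eq_iff by presburger
qed

text \<open>Comparing eigencomponents \<open>w l\<close> of e_u and \<open>z l\<close> of e_v gives
  \<open>cis (t * l)\<close> w_l = \<gamma> z_l. Both scalars are unimodular and both vectors real,
  so \<open>z l\<close> is plus or minus \<open>w l\<close>.\<close>

lemma PST_strongly_cospectral:
  assumes G: "simple_graph E" and pst: "PST E u v t"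
  obtains T :: "real set" and w :: "real \<Rightarrow> real^'n" and c :: "real \<Rightarrow> int" and \<gamma> :: complex
  where "finite T" "\<And>l. l \<in> T \<Longrightarrow> real_adj E *v w l = l *\<^sub>R w l" "\<And>l. l \<in> T \<Longrightarrow> w l \<noteq> 0"
    "\<And>l. l \<in> T \<Longrightarrow> c l = 1 \<or> c l = - 1"
    "axis u 1 = (\<Sum>l\<in>T. w l)" "axis v 1 = (\<Sum>l\<in>T. of_int (c l) *\<^sub>R w l)"
    "norm \<gamma> = 1" "\<And>l. l \<in> T \<Longrightarrow> cis (t * l) = \<gamma> * of_int (c l)"
proof -
  let ?A = "real_adj E"
  note sym = symmetric_matrix_inner[OF transpose_real_adj[OF G]]
  obtain Su w where w: "finite Su" "axis u 1 = (\<Sum>l\<in>Su. w l)" "\<And>l. ?A *v w l = l *\<^sub>R w l"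
    "\<And>l. l \<notin> Su \<Longrightarrow> w l = 0"
    using selfadjoint_decomposition[of "(*v) ?A" "axis u 1", OF _ sym] by auto
  obtain Sv z where z: "finite Sv" "axis v 1 = (\<Sum>l\<in>Sv. z l)" "\<And>l. ?A *v z l = l *\<^sub>R z l"
    "\<And>l. l \<notin> Sv \<Longrightarrow> z l = 0"
    using selfadjoint_decomposition[of "(*v) ?A" "axis v 1", OF _ sym] by auto
  define S where "S = Su \<union> Sv"
  have S: "finite S" using w(1) z(1) by (simp add: S_def)
  have u: "axis u 1 = (\<Sum>l\<in>S. w l)"
    unfolding w(2) S_def using w(1,4) z(1) by (intro sum.mono_neutral_left) auto
  have v: "axis v 1 = (\<Sum>l\<in>S. z l)"
    unfolding z(2) S_def using z(1,4) w(1) by (intro sum.mono_neutral_left) auto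
  obtain \<gamma> where \<gamma>: "norm \<gamma> = 1"
    "\<And>a. (\<Sum>l\<in>S. cis (t * l) * of_real (w l $ a)) = \<gamma> * of_real (axis v 1 $ a)"
    using pst PST_spectral_iff[of S E w u v t] w(3) u by blast
  have eq: "(\<Sum>l\<in>S. cis (t * l) * of_real (w l $ a)) = (\<Sum>l\<in>S. \<gamma> * of_real (z l $ a))" for a
    unfolding \<gamma>(2) v by (simp add: sum_distrib_left)
  \<comment> \<open>Real and imaginary parts are compared separately because independence is
    available for real vectors.\<close>
  have "(\<Sum>l\<in>S. cos (t * l) *\<^sub>R w l - Re \<gamma> *\<^sub>R z l) = 0"
    using arg_cong[OF eq, of Re] by (simp add: vec_eq_iff sum_subtractf)
  then have re: "cos (t * l) *\<^sub>R w l - Re \<gamma> *\<^sub>R z l = 0" if "l \<in> S" for l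
    using selfadjoint_eigenvectors_independent[of "(*v) ?A" S "\<lambda>l. cos (t * l) *\<^sub>R w l - Re \<gamma> *\<^sub>R z l" l, OF sym S]
      that w(3) z(3) by (simp add: linear_diff linear_scale algebra_simps)
  have "(\<Sum>l\<in>S. sin (t * l) *\<^sub>R w l - Im \<gamma> *\<^sub>R z l) = 0"
    using arg_cong[OF eq, of Im] by (simp add: vec_eq_iff sum_subtractf)
  then have im: "sin (t * l) *\<^sub>R w l - Im \<gamma> *\<^sub>R z l = 0" if "l \<in> S" for l
    using selfadjoint_eigenvectors_independent[of "(*v) ?A" S "\<lambda>l. sin (t * l) *\<^sub>R w l - Im \<gamma> *\<^sub>R z l" l, OF sym S]
      that w(3) z(3) by (simp add: linear_diff linear_scale algebra_simps)
  \<comment> \<open>This is the real part of \<open>cis (t * l)\<close> times the conjugate of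
    \<gamma>. It maps \<open>w l\<close> to \<open>z l\<close> and back, so its square is 1 on
    nonzero components.\<close>
  define d where "d l = cos (t * l) * Re \<gamma> + sin (t * l) * Im \<gamma>" for l
  have g1: "(Re \<gamma>)\<^sup>2 + (Im \<gamma>)\<^sup>2 = 1"
    using \<gamma>(1) by (metis cmod_power2 one_power2)
  have zd: "z l = d l *\<^sub>R w l" if "l \<in> S" for l
  proof -
    have "z l = ((Re \<gamma>)\<^sup>2 + (Im \<gamma>)\<^sup>2) *\<^sub>R z l" by (simp add: g1)
    also have "\<dots> = Re \<gamma> *\<^sub>R (Re \<gamma> *\<^sub>R z l) + Im \<gamma> *\<^sub>R (Im \<gamma> *\<^sub>R z l)"
      by (simp add: power2_eq_square algebra_simps)
    also have "\<dots> = Re \<gamma> *\<^sub>R (cos (t * l) *\<^sub>R w l) + Im \<gamma> *\<^sub>R (sin (t * l) *\<^sub>R w l)"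
      using re[OF that] im[OF that] by simp
    finally show ?thesis by (simp add: d_def algebra_simps)
  qed
  have wd: "w l = d l *\<^sub>R z l" if "l \<in> S" for l
  proof -
    have "w l = ((cos (t * l))\<^sup>2 + (sin (t * l))\<^sup>2) *\<^sub>R w l" by simp
    also have "\<dots> = cos (t * l) *\<^sub>R (cos (t * l) *\<^sub>R w l) + sin (t * l) *\<^sub>R (sin (t * l) *\<^sub>R w l)"
      by (simp only: power2_eq_square scaleR_add_left scaleR_scaleR)
    also have "\<dots> = cos (t * l) *\<^sub>R (Re \<gamma> *\<^sub>R z l) + sin (t * l) *\<^sub>R (Im \<gamma> *\<^sub>R z l)"
      using re[OF that] im[OF that] by simp
    finally show ?thesis by (simp add: d_def algebra_simps)
  qed
  define T where "T = {l\<in>S. w l \<noteq> 0}"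
  define c :: "real \<Rightarrow> int" where "c l = (if d l = 1 then 1 else - 1)" for l
  have dc: "d l = of_int (c l)" if "l \<in> T" for l
  proof -
    have "w l = (d l * d l) *\<^sub>R w l" using that wd[of l] zd[of l] by (simp add: T_def)
    then have "(d l * d l - 1) *\<^sub>R w l = 0" by (simp add: algebra_simps)
    then have "d l * d l = 1" using that by (simp add: T_def)
    then show ?thesis by (auto simp: c_def square_eq_1_iff)
  qed
  show thesis
  proof (rule that[of T w c \<gamma>])
    show "finite T" using S by (simp add: T_def)
    show "axis u 1 = (\<Sum>l\<in>T. w l)"
      unfolding u T_def using S by (intro sum.mono_neutral_right) auto
    \<comment> \<open>Discarding the indices with \<open>w l = 0\<close> loses nothing here, since
      \<open>zd\<close> makes \<open>z l\<close> vanish there too.\<close>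
    have "axis v 1 = (\<Sum>l\<in>T. z l)"
      unfolding v T_def using S zd by (intro sum.mono_neutral_right) auto
    then show "axis v 1 = (\<Sum>l\<in>T. of_int (c l) *\<^sub>R w l)"
      using zd dc by (simp add: T_def)
    fix l assume l: "l \<in> T"
    show "?A *v w l = l *\<^sub>R w l" by (rule w(3))
    show "w l \<noteq> 0" using l by (simp add: T_def)
    show "c l = 1 \<or> c l = - 1" by (simp add: c_def)
    have "(cos (t * l) - Re \<gamma> * d l) *\<^sub>R w l = 0" "(sin (t * l) - Im \<gamma> * d l) *\<^sub>R w l = 0"
      using re[of l] im[of l] zd[of l] l by (simp_all add: T_def algebra_simps)
    then have "cos (t * l) = Re \<gamma> * d l" "sin (t * l) = Im \<gamma> * d l"
      using l by (simp_all add: T_def)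
    then show "cis (t * l) = \<gamma> * of_int (c l)"
      using dc[OF l] by (simp add: complex_eq_iff)
  qed (rule \<gamma>(1))
qed

text \<open>The converse, used to exhibit an earlier transfer time.\<close>

lemma PST_of_strongly_cospectral:
  assumes "\<And>l. l \<in> T \<Longrightarrow> real_adj E *v w l = l *\<^sub>R w l" "axis u 1 = (\<Sum>l\<in>T. w l)"
    "axis v 1 = (\<Sum>l\<in>T. of_int (c l) *\<^sub>R w l)" "u \<noteq> v" "s > 0" "norm \<gamma> = 1"
    "\<And>l. l \<in> T \<Longrightarrow> cis (s * l) = \<gamma> * of_int (c l)"
  shows "PST E u v s"
proof -
  have "(\<Sum>l\<in>T. cis (s * l) * of_real (w l $ a)) = \<gamma> * of_real (axis v 1 $ a)" for a
    unfolding assms(3) using assms(7) by (simp add: sum_distrib_left mult.assoc)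
  then show ?thesis
    using PST_spectral_iff[of T E w u v s] assms by blast
qed

lemma cis_eq_sign_imp_pi_multiple:
  assumes "cis x = of_int s" "s = 1 \<or> s = - 1"
  obtains n :: int where "x = of_int n * pi" "even n \<longleftrightarrow> s = 1"
proof -
  have cs: "cos x = of_int s" "sin x = 0"
    using arg_cong[OF assms(1), of Re] arg_cong[OF assms(1), of Im] by (simp_all add:)
  obtain n :: int where n: "x = of_int n * pi" using cs(2) sin_zero_iff_int2 by blast
  have "cos x = (if even n then 1 else - 1)"
    using cos_npi_int[of n] by (simp add: n mult.commute)
  then have "even n \<longleftrightarrow> s = 1" using cs(1) assms(2) by (auto split: if_splits)
  with n show thesis by (rule that)
qed

lemma cis_pi_multiple: "cis (of_int n * pi) = (if even n then 1 else - 1)"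
  using cos_npi_int[of n] sin_npi_int[of n]
  by (simp add: mult.commute complex_eq_iff)

section \<open>Minimality of the time and the bound on the step\<close>

theorem theorem14:
  fixes E :: "'n::finite \<Rightarrow> 'n \<Rightarrow> bool" and u v :: 'n and t :: real
  assumes "simple_graph E"
    and "PST E u v t"
    and "\<forall>s. PST E u v s \<longrightarrow> t \<le> s"
  shows "t \<le> pi / sqrt 2"
proof -
  let ?A = "real_adj E"
  have uv: "u \<noteq> v" and t: "t > 0" using assms(2) by (auto simp: PST_def)
  obtain T w c \<gamma> where T: "finite T" and eig: "\<And>l. l \<in> T \<Longrightarrow> ?A *v w l = l *\<^sub>R w l"
    and nz: "\<And>l. l \<in> T \<Longrightarrow> w l \<noteq> 0" and c: "\<And>l. l \<in> T \<Longrightarrow> c l = 1 \<or> c l = - 1"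
    and u: "axis u 1 = (\<Sum>l\<in>T. w l)" and v: "axis v 1 = (\<Sum>l\<in>T. of_int (c l) *\<^sub>R w l)"
    and \<gamma>: "norm \<gamma> = 1" and phase: "\<And>l. l \<in> T \<Longrightarrow> cis (t * l) = \<gamma> * of_int (c l)"
    using PST_strongly_cospectral[OF assms(1,2)] by blast
  have "T \<noteq> {}" using u by (auto simp: axis_eq_0_iff)
  then obtain k where k: "k \<in> T" by blast
  have sign_mult: "c l * c k = 1 \<longleftrightarrow> c l = c k" if "l \<in> T" for l
    using c[OF that] c[OF k] by auto
  \<comment> \<open>Dividing the phases at \<open>l\<close> and \<open>k\<close> cancels \<gamma>
    and leaves a sign.\<close>
  have "\<exists>n::int. t * (l - k) = of_int n * pi \<and> (even n \<longleftrightarrow> c l = c k)" if l: "l \<in> T" for l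
  proof -
    have "cis (t * (l - k)) = cis (t * l) / cis (t * k)"
      by (simp add: cis_divide algebra_simps)
    also have "\<dots> = of_int (c l * c k)"
      using \<gamma> c[OF l] c[OF k] by (auto simp: phase[OF l] phase[OF k])
    finally obtain n :: int where "t * (l - k) = of_int n * pi" "even n \<longleftrightarrow> c l * c k = 1"
      by (rule cis_eq_sign_imp_pi_multiple) (use c[OF l] c[OF k] in auto)
    then show ?thesis using sign_mult[OF l] by blast
  qed
  then obtain m :: "real \<Rightarrow> int" where m: "\<And>l. l \<in> T \<Longrightarrow> t * (l - k) = of_int (m l) * pi"
    and m_even: "\<And>l. l \<in> T \<Longrightarrow> even (m l) \<longleftrightarrow> c l = c k"
    by metis
  \<comment> \<open>With a single sign, e_v would be plus or minus e_u. The eigenvalue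
    \<open>l1\<close> supplies an odd \<open>m l1\<close>, so \<open>g\<close> is odd.\<close>
  obtain l1 where l1: "l1 \<in> T" "c l1 \<noteq> c k"
  proof (rule ccontr)
    assume "\<not> thesis"
    then have "\<And>l. l \<in> T \<Longrightarrow> c l = c k" using that by blast
    then have "axis v 1 = (of_int (c k) *\<^sub>R axis u 1 :: real^'n)"
      unfolding u v by (simp add: scaleR_sum_right)
    then have "axis v 1 $ v = (of_int (c k) *\<^sub>R axis u 1 :: real^'n) $ v" by simp
    then show False using uv by (simp add: axis_def)
  qed
  define g where "g = Gcd (m ` T)"
  have g_dvd: "g dvd m l" if "l \<in> T" for l using that by (simp add: g_def)
  have "odd (m l1)" using l1 m_even by blast
  then have g_odd: "odd g" using g_dvd[OF l1(1)] dvd_trans by blast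
  moreover have "g \<ge> 0" by (simp add: g_def)
  ultimately have g_pos: "g > 0" by (cases "g = 0") auto
  \<comment> \<open>Dividing \<open>m l\<close> by the odd \<open>g\<close> preserves its parity, so
    the relative signs at time \<open>t / g\<close> are those at time \<open>t\<close>.\<close>
  have "PST E u v (t / of_int g)"
  proof (rule PST_of_strongly_cospectral[OF eig u v uv])
    define s where "s = t / of_int g"
    show "t / of_int g > 0" using t g_pos by simp
    show "norm (cis (s * k) * of_int (c k)) = 1"
      using c[OF k] by (auto simp: norm_mult)
    fix l assume l: "l \<in> T"
    obtain n where n: "m l = g * n" using g_dvd[OF l] by blast
    have "s * (l - k) = of_int n * pi"
      using m[OF l] g_pos by (simp add: s_def n field_simps)
    then have "cis (s * (l - k)) = of_int (c l * c k)"
      using cis_pi_multiple[of n] m_even[OF l] g_odd c[OF l] c[OF k] by (auto simp: n)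
    moreover have "cis (s * l) = cis (s * k) * cis (s * (l - k))"
      by (simp add: cis_mult algebra_simps)
    ultimately show "cis (t / of_int g * l) = cis (s * k) * of_int (c k) * of_int (c l)"
      by (simp add: s_def mult_ac)
  qed
  then have "t \<le> t / of_int g" using assms(3) by blast
  then have "g \<le> 1" using t g_pos by (simp add: field_simps)
  then have g1: "Gcd (m ` T) = 1" using g_pos by (simp add: g_def)
  define s where "s = pi / t"
  have s: "s > 0" using t by (simp add: s_def)
  have step: "l - l' = s * of_int (m l - m l')" if "l \<in> T" "l' \<in> T" for l l'
    using m[OF that(1)] m[OF that(2)] t by (simp add: s_def field_simps)
  have mk: "m k = 0" using m[OF k] by simp
  have e_int: "(\<Sum>l\<in>T. w l) $ i \<in> \<int>" for i
    by (simp only: u[symmetric]) (simp add: axis_def)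
  note p_rat = power_sums_rational[OF T support_poly_rational[OF real_adj_Ints
        transpose_real_adj[OF assms(1)] e_int T eig nz]]
  have s2_rat: "s\<^sup>2 \<in> \<rat>"
  proof (rule square_of_common_step_rational[OF T p_rat step l1(1) k])
    show "m l1 \<noteq> m k" using mk \<open>odd (m l1)\<close> by auto
  qed
  have "s\<^sup>2 \<in> \<int>"
  proof (rule Ints_of_coprime_square_multiples[OF s2_rat g1])
    fix l assume l: "l \<in> T"
    have eq: "s\<^sup>2 * (of_int (m l))\<^sup>2 = (l - k)\<^sup>2"
      by (simp add: step[OF l k] mk power_mult_distrib)
    have "(l - k)\<^sup>2 \<in> \<rat>" unfolding eq[symmetric] using s2_rat by simp
    then show "s\<^sup>2 * (of_int (m l))\<^sup>2 \<in> \<int>"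
      unfolding eq
      by (rule rational_square_eigenvalue_diff_is_int[OF real_adj_Ints eig[OF l] nz[OF l] eig[OF k] nz[OF k]])
  qed
  then obtain S where S: "s\<^sup>2 = of_int S" using Ints_cases by blast
  have "S \<noteq> 1"
  proof
    assume "S = 1"
    then have s1: "s = 1" using S s by (simp add: power2_eq_1_iff)
    have shift: "l = k + of_int (m l)" if "l \<in> T" for l
      using step[OF that k] by (simp add: s1 mk)
    \<comment> \<open>The rational sum of \<open>T\<close> equals \<open>card T * k\<close> plus an
      integer, so \<open>k\<close> is rational, hence an integer.\<close>
    have "(\<Sum>l\<in>T. l) = (\<Sum>l\<in>T. k + of_int (m l))"
      using shift by (intro sum.cong) auto
    also have "\<dots> = of_nat (card T) * k + of_int (\<Sum>l\<in>T. m l)"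
      by (simp add: sum.distrib)
    finally have "k = ((\<Sum>l\<in>T. l) - of_int (\<Sum>l\<in>T. m l)) / of_nat (card T)"
      using T k by (simp add: field_simps) auto
    also have "\<dots> \<in> \<rat>" using p_rat(1) by (intro Rats_divide Rats_diff) auto
    finally have "k \<in> \<rat>" .
    then have "k \<in> \<int>" by (rule rational_eigenvalue_is_int[OF real_adj_Ints eig[OF k] nz[OF k]])
    then have ints: "l \<in> \<int>" if "l \<in> T" for l
      using shift[OF that] by (metis Ints_add Ints_of_int)
    define X where "X = floor ` T"
    have TX: "T = of_int ` X" and inj: "inj_on (of_int :: int \<Rightarrow> real) X"
      using ints by (force simp: X_def image_image, simp add: inj_on_def)
    have "\<exists>x\<in>X. \<exists>y\<in>X. c (of_int x) = 1 \<and> c (of_int y) = - 1 \<and> even (x - y)"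
    proof (rule integer_spectrum_parity[OF real_adj_Ints])
      show "finite X" using T by (simp add: X_def)
      show "axis u 1 = (\<Sum>x\<in>X. w (of_int x))"
        unfolding u by (subst TX, subst sum.reindex[OF inj]) (simp add: o_def)
      show "axis v 1 = (\<Sum>x\<in>X. of_int (c (of_int x)) *\<^sub>R w (of_int x))"
        unfolding v by (subst TX, subst sum.reindex[OF inj]) (simp add: o_def)
      show "u \<noteq> v" by (rule uv)
    qed (use eig c TX in auto)
    then obtain x y where xy: "of_int x \<in> T" "of_int y \<in> T" "c (of_int x) = 1" "c (of_int y) = - 1" "even (x - y)"
      using TX by blast
    \<comment> \<open>With unit step, eigenvalue differences are differences of \<open>m\<close>, so
      equal parity would force equal signs.\<close>
    have "x - y = m (of_int x) - m (of_int y)"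
      using step[OF xy(1,2)] by (simp add: s1 flip: of_int_diff)
    with xy(5) have "even (m (of_int x)) \<longleftrightarrow> even (m (of_int y))" by simp
    then show False
      using c[OF k] by (simp add: m_even[OF xy(1)] m_even[OF xy(2)] xy(3,4)) linarith
  qed
  moreover have "of_int S > (0 :: real)" unfolding S[symmetric] using s by simp
  ultimately have "S \<ge> 2" by simp
  then have "2 \<le> s\<^sup>2" unfolding S by simp
  then have "sqrt 2 \<le> s" using s by (simp add: real_le_lsqrt)
  then show ?thesis using t by (simp add: s_def field_simps)
qed

end
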